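(* Let $G_1$ be a cograph and $x\in V(G_1)$. (a) If $G_2$ is obtained from $G_1$ by adding a true twin $y$ of $x$, then $ccn(G_1)\le ccn(G_2)$. (b) If $G_3$ is obtained from $G_1$ by adding a false twin $z$ of $x$, then $ccn(G_1)=ccn(G_3)$.
   Context: A cograph is a graph with no induced path on $4$ vertices. Adding a true twin $y$ of $x$ means adding a new vertex $y$ with $N[y]=N[x]$; adding a false twin $z$ of $x$ means adding a new vertex $z$ with $N(z)=N(x)$. Game of Cops and Robbers: cops choose vertices first, then the robber; players alternate, each moving to an adjacent vertex or staying; capture when a cop occupies the robber's vertex. The robber is confined if it has to stay at its current vertex in order to avoid capture in the next move of the cops. $ccn(G)$, the confining cop number, is the minimum number of cops that can force confinement (or capture) of the robber. *)

theory Defs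
  imports "Graph_Theory.Graph_Theory"
begin

text \<open>
  A finite simple graph is a \<open>pair_graph\<close>: a finite, loop-free, symmetric digraph without parallel
  arcs, in which each edge is represented by its two orientations.
\<close>

definition nbhd :: "'a pair_pre_digraph \<Rightarrow> 'a \<Rightarrow> 'a set" where
  "nbhd G v = {w. v \<rightarrow>\<^bsub>with_proj G\<^esub> w}"

definition closed_nbhd :: "'a pair_pre_digraph \<Rightarrow> 'a \<Rightarrow> 'a set" where
  "closed_nbhd G v = insert v (nbhd G v)"

definition induced_P4 :: "'a pair_pre_digraph \<Rightarrow> 'a \<Rightarrow> 'a \<Rightarrow> 'a \<Rightarrow> 'a \<Rightarrow> bool" where
  "induced_P4 G a b c d \<longleftrightarrow>
     {a, b, c, d} \<subseteq> pverts G \<and> distinct [a, b, c, d] \<and>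
     b \<in> nbhd G a \<and> c \<in> nbhd G b \<and> d \<in> nbhd G c \<and>
     c \<notin> nbhd G a \<and> d \<notin> nbhd G a \<and> d \<notin> nbhd G b"

definition cograph :: "'a pair_pre_digraph \<Rightarrow> bool" where
  "cograph G \<longleftrightarrow> pair_graph G \<and> (\<nexists>a b c d. induced_P4 G a b c d)"

definition adds_vertex :: "'a pair_pre_digraph \<Rightarrow> 'a \<Rightarrow> 'a pair_pre_digraph \<Rightarrow> bool" where
  "adds_vertex G y G' \<longleftrightarrow>
     pair_graph G' \<and> y \<notin> pverts G \<and> pverts G' = insert y (pverts G) \<and>
     induced_subgraph (with_proj G) (with_proj G')"

definition adds_true_twin ::
  "'a pair_pre_digraph \<Rightarrow> 'a \<Rightarrow> 'a \<Rightarrow> 'a pair_pre_digraph \<Rightarrow> bool" where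
  "adds_true_twin G x y G' \<longleftrightarrow> adds_vertex G y G' \<and> closed_nbhd G' y = closed_nbhd G' x"

definition adds_false_twin ::
  "'a pair_pre_digraph \<Rightarrow> 'a \<Rightarrow> 'a \<Rightarrow> 'a pair_pre_digraph \<Rightarrow> bool" where
  "adds_false_twin G x z G' \<longleftrightarrow> adds_vertex G z G' \<and> nbhd G' z = nbhd G' x"

text \<open>
  The positions of \<open>k\<close> cops form a list of length \<open>k\<close>, so several cops may share a vertex.
\<close>

definition cops_move :: "'a pair_pre_digraph \<Rightarrow> 'a list \<Rightarrow> 'a list \<Rightarrow> bool" where
  "cops_move G C C' \<longleftrightarrow> list_all2 (\<lambda>c c'. c' \<in> closed_nbhd G c) C C'"

definition captured :: "'a list \<Rightarrow> 'a \<Rightarrow> bool" where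
  "captured C v \<longleftrightarrow> v \<in> set C"

text \<open>
  With the robber to move from \<open>v\<close>: leaving \<open>v\<close> for any neighbour allows the cops to capture
  her in their next move. Whether staying at \<open>v\<close> is safe is left open; if it is not, then the
  cops capture the robber in their next move whatever she does.
\<close>

definition confined :: "'a pair_pre_digraph \<Rightarrow> 'a list \<Rightarrow> 'a \<Rightarrow> bool" where
  "confined G C v \<longleftrightarrow> (\<forall>w \<in> nbhd G v. \<exists>C'. cops_move G C C' \<and> captured C' w)"

text \<open>
  \<open>r 0\<close> is the vertex the robber chooses initially, and \<open>r n\<close> is her vertex after her \<open>n\<close>-th move.
\<close>

definition robber_play :: "'a pair_pre_digraph \<Rightarrow> (nat \<Rightarrow> 'a) \<Rightarrow> bool" where
  "robber_play G r \<longleftrightarrow> r 0 \<in> pverts G \<and> (\<forall>n. r (Suc n) \<in> closed_nbhd G (r n))"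

text \<open>
  A strategy \<open>\<sigma>\<close> of the cops maps the robber's positions so far to the cops' next positions:
  \<open>\<sigma> []\<close> is their initial choice, and \<open>\<sigma> [r 0, \<dots>, r n]\<close> is their answer to the robber being
  at \<open>r n\<close>. So when the robber arrives at \<open>r n\<close> the cops are at \<open>cops_at \<sigma> r n\<close>, and they
  then move to \<open>cops_at \<sigma> r (Suc n)\<close>.
\<close>

definition cops_at :: "('a list \<Rightarrow> 'a list) \<Rightarrow> (nat \<Rightarrow> 'a) \<Rightarrow> nat \<Rightarrow> 'a list" where
  "cops_at \<sigma> r n = \<sigma> (map r [0..<n])"

definition cops_strategy :: "'a pair_pre_digraph \<Rightarrow> nat \<Rightarrow> ('a list \<Rightarrow> 'a list) \<Rightarrow> bool" where
  "cops_strategy G k \<sigma> \<longleftrightarrow>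
     length (\<sigma> []) = k \<and> set (\<sigma> []) \<subseteq> pverts G \<and>
     (\<forall>r. robber_play G r \<longrightarrow> (\<forall>n. cops_move G (cops_at \<sigma> r n) (cops_at \<sigma> r (Suc n))))"

text \<open>
  The first disjunct below is the robber moving onto (or choosing) a vertex occupied by a cop.
\<close>

definition forces_confinement :: "'a pair_pre_digraph \<Rightarrow> ('a list \<Rightarrow> 'a list) \<Rightarrow> bool" where
  "forces_confinement G \<sigma> \<longleftrightarrow>
     (\<forall>r. robber_play G r \<longrightarrow>
        (\<exists>n. captured (cops_at \<sigma> r n) (r n) \<or>
             captured (cops_at \<sigma> r (Suc n)) (r n) \<or>
             confined G (cops_at \<sigma> r (Suc n)) (r n)))"

text \<open>
  As usual, the game is played with at least one cop. On a nonempty finite graph, \<open>card (pverts G)\<close>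
  cops occupying all vertices win, so the minimum exists.
\<close>

definition ccn :: "'a pair_pre_digraph \<Rightarrow> nat" where
  "ccn G = (LEAST k. k \<ge> 1 \<and> (\<exists>\<sigma>. cops_strategy G k \<sigma> \<and> forces_confinement G \<sigma>))"

end

theory Submission
  imports Defs
begin

text \<open>
  Sending the new twin to \<open>x\<close> is a retraction \<open>f\<close> of the larger graph onto \<open>G1\<close>. The cops on
  \<open>G1\<close> play the \<open>f\<close>-image of a winning strategy of the larger graph, so passing to a retract
  cannot increase the confining cop number.

  Conversely, for a false twin \<open>z\<close>, the cops on \<open>G3\<close> answer the \<open>f\<close>-image of the robber in \<open>G1\<close>,
  but seize this image as soon as they can and then never move again. Seizing the image captures
  the robber unless she is at \<open>z\<close> with a cop at \<open>x\<close>, and then she is confined because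
  \<open>N(z) = N(x)\<close>. If the image can never be seized but becomes confined, no cop at \<open>x\<close> is adjacent
  to it; so whichever cop guards \<open>x\<close> against the image does so from a neighbour of \<open>x\<close>, and guards
  \<open>z\<close> as well.
\<close>

section \<open>Capture and confinement in terms of single cops\<close>

definition can_capture :: "'a pair_pre_digraph \<Rightarrow> 'a list \<Rightarrow> 'a \<Rightarrow> bool" where
  "can_capture G C v \<longleftrightarrow> (\<exists>c \<in> set C. v \<in> closed_nbhd G c)"

lemma cops_stay: "cops_move G C C"
  by (simp add: cops_move_def closed_nbhd_def list_all2_same)

text \<open>One cop within reach of \<open>v\<close> can step there while all others stay, so the
  quantifier over joint moves reduces to a condition on individual cops.\<close>

lemma can_capture_iff: "can_capture G C v \<longleftrightarrow> (\<exists>C'. cops_move G C C' \<and> captured C' v)"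
proof
  assume "can_capture G C v"
  then obtain i where i: "i < length C" "v \<in> closed_nbhd G (C ! i)"
    unfolding can_capture_def by (metis in_set_conv_nth)
  have "cops_move G C (C[i := v])"
    using i by (auto simp: cops_move_def list_all2_conv_all_nth nth_list_update closed_nbhd_def)
  moreover have "captured (C[i := v]) v"
    using i by (simp add: captured_def set_update_memI)
  ultimately show "\<exists>C'. cops_move G C C' \<and> captured C' v" by blast
next
  assume "\<exists>C'. cops_move G C C' \<and> captured C' v"
  then obtain C' i where "cops_move G C C'" "i < length C'" "v = C' ! i"
    unfolding captured_def by (metis in_set_conv_nth)
  then have "i < length C" "v \<in> closed_nbhd G (C ! i)"
    by (auto simp: cops_move_def list_all2_conv_all_nth)
  then show "can_capture G C v"
    unfolding can_capture_def using nth_mem by blast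
qed

lemma confined_iff: "confined G C v \<longleftrightarrow> (\<forall>w \<in> nbhd G v. can_capture G C w)"
  by (simp add: confined_def can_capture_iff)

lemma captured_imp_can_capture: "captured C v \<Longrightarrow> can_capture G C v"
  by (auto simp: captured_def can_capture_def closed_nbhd_def)

section \<open>Neighbourhoods in simple graphs\<close>

lemma nbhd_iff: "w \<in> nbhd G v \<longleftrightarrow> (v, w) \<in> parcs G"
  by (simp add: nbhd_def)

lemma nbhd_subset_pverts:
  assumes "pair_graph G"
  shows "nbhd G v \<subseteq> pverts G"
proof -
  interpret pair_graph G by fact
  show ?thesis using in_arcsD2 by (auto simp: nbhd_iff)
qed

lemma nbhd_sym:
  assumes "pair_graph G"
  shows "w \<in> nbhd G v \<longleftrightarrow> v \<in> nbhd G w"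
proof -
  interpret pair_graph G by fact
  show ?thesis using arcs_symmetric by (auto simp: nbhd_iff)
qed

lemma nbhd_irrefl:
  assumes "pair_graph G"
  shows "v \<notin> nbhd G v"
proof -
  interpret pair_graph G by fact
  show ?thesis using no_loops' by (auto simp: nbhd_iff)
qed

lemma robber_play_in_pverts:
  assumes "pair_graph G" "robber_play G r"
  shows "r n \<in> pverts G"
proof (induction n)
  case 0
  then show ?case using assms(2) by (simp add: robber_play_def)
next
  case (Suc n)
  have "r (Suc n) \<in> closed_nbhd G (r n)"
    using assms(2) by (simp add: robber_play_def)
  then show ?case
    using Suc nbhd_subset_pverts[OF assms(1), of "r n"] by (auto simp: closed_nbhd_def)
qed

section \<open>Attainment and comparison of confining cop numbers\<close>

definition confining_number :: "'a pair_pre_digraph \<Rightarrow> nat \<Rightarrow> bool" where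
  "confining_number G k \<longleftrightarrow> k \<ge> 1 \<and> (\<exists>\<sigma>. cops_strategy G k \<sigma> \<and> forces_confinement G \<sigma>)"

text \<open>Cops on all vertices capture the robber as soon as she chooses one, so the predicate
  under \<open>LEAST\<close> in \<open>ccn\<close> is satisfiable and the minimum is
  attained.\<close>

lemma confining_number_ccn:
  assumes "pair_graph G" "pverts G \<noteq> {}"
  shows "confining_number G (ccn G)"
proof -
  have "finite (pverts G)"
    using assms(1)
    by (simp add: pair_graph.axioms pair_digraph.axioms pair_fin_digraph.pair_finite_verts)
  then obtain C where C: "set C = pverts G" using finite_list by blast
  have "cops_strategy G (length C) (\<lambda>h. C)"
    using C by (simp add: cops_strategy_def cops_at_def cops_stay)
  moreover have "forces_confinement G (\<lambda>h. C)"
    using C by (auto simp: forces_confinement_def cops_at_def captured_def robber_play_def)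
  moreover have "length C \<ge> 1"
    using C assms(2) by (cases C) auto
  ultimately have "confining_number G (length C)"
    unfolding confining_number_def by blast
  then show ?thesis
    unfolding ccn_def confining_number_def[symmetric] by (rule LeastI)
qed

lemma ccn_mono:
  assumes "pair_graph G'" "pverts G' \<noteq> {}"
    and "\<And>k. confining_number G' k \<Longrightarrow> confining_number G k"
  shows "ccn G \<le> ccn G'"
proof -
  have "confining_number G (ccn G')"
    using assms confining_number_ccn by blast
  then show ?thesis
    unfolding ccn_def[of G] confining_number_def[symmetric] by (rule Least_le)
qed

section \<open>Retracts\<close>

text \<open>Adjacency is preserved only up to equality, because a true twin is adjacent to the
  vertex it collapses to. The last clause ranges over all \<open>v\<close>, so joint cop moves
  transfer without first checking that the cops stand on vertices.\<close>

definition retraction :: "('a \<Rightarrow> 'a) \<Rightarrow> 'a pair_pre_digraph \<Rightarrow> 'a pair_pre_digraph \<Rightarrow> bool" where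
  "retraction f G' G \<longleftrightarrow>
     pverts G \<subseteq> pverts G' \<and> (\<forall>v. nbhd G v \<subseteq> nbhd G' v) \<and>
     f ` pverts G' \<subseteq> pverts G \<and> (\<forall>v \<in> pverts G. f v = v) \<and>
     (\<forall>v. \<forall>w \<in> closed_nbhd G' v. f w \<in> closed_nbhd G (f v))"

text \<open>A robber of \<open>G\<close> also plays legally in \<open>G'\<close>, where
  \<open>\<sigma>\<close> can answer her. As \<open>f\<close> fixes the vertices of
  \<open>G\<close>, a cop that occupies or guards such a vertex in \<open>G'\<close> has an image
  that does so in \<open>G\<close>.\<close>

lemma confining_number_retract:
  assumes G: "pair_graph G" and f: "retraction f G' G" and k: "confining_number G' k"
  shows "confining_number G k"
proof -
  obtain \<sigma> where k1: "k \<ge> 1" and \<sigma>: "cops_strategy G' k \<sigma>" "forces_confinement G' \<sigma>"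
    using k unfolding confining_number_def by blast
  define \<tau> where "\<tau> = map f \<circ> \<sigma>"
  have at: "cops_at \<tau> r n = map f (cops_at \<sigma> r n)" for r n
    by (simp add: \<tau>_def cops_at_def)
  have play: "robber_play G' r" if "robber_play G r" for r
    using that f unfolding robber_play_def retraction_def closed_nbhd_def by blast
  have move: "cops_move G (map f C) (map f C')" if "cops_move G' C C'" for C C'
    using that f unfolding cops_move_def retraction_def
    by (auto simp: list_all2_map1 list_all2_map2 elim!: list_all2_mono)
  have capt: "captured (map f C) v" if "captured C v" "v \<in> pverts G" for C v
    using that f by (force simp: captured_def retraction_def)
  have guard: "can_capture G (map f C) v" if "can_capture G' C v" "v \<in> pverts G" for C v
    using that f by (force simp: can_capture_def retraction_def)
  have conf: "confined G (map f C) v" if "confined G' C v" for C v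
    unfolding confined_iff
  proof
    fix w assume w: "w \<in> nbhd G v"
    then have "w \<in> nbhd G' v" "w \<in> pverts G"
      using f nbhd_subset_pverts[OF G] unfolding retraction_def by blast+
    then show "can_capture G (map f C) w"
      using that guard unfolding confined_iff by blast
  qed
  have "cops_strategy G k \<tau>"
    using \<sigma>(1) f play move unfolding cops_strategy_def at
    by (simp add: \<tau>_def retraction_def) blast
  moreover have "forces_confinement G \<tau>"
    unfolding forces_confinement_def at
  proof (intro allI impI)
    fix r assume r: "robber_play G r"
    obtain n where "captured (cops_at \<sigma> r n) (r n) \<or> captured (cops_at \<sigma> r (Suc n)) (r n) \<or>
        confined G' (cops_at \<sigma> r (Suc n)) (r n)"
      using \<sigma>(2) play[OF r] unfolding forces_confinement_def by blast
    then show "\<exists>n. captured (map f (cops_at \<sigma> r n)) (r n) \<or>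
        captured (map f (cops_at \<sigma> r (Suc n))) (r n) \<or>
        confined G (map f (cops_at \<sigma> r (Suc n))) (r n)"
      using capt conf robber_play_in_pverts[OF G r] by blast
  qed
  ultimately show ?thesis
    using k1 unfolding confining_number_def by blast
qed

section \<open>Cops that seize at the first opportunity and then freeze\<close>

definition seize :: "'a pair_pre_digraph \<Rightarrow> 'a list \<Rightarrow> 'a \<Rightarrow> 'a list" where
  "seize G C v = (SOME C'. cops_move G C C' \<and> captured C' v)"

lemma seize:
  assumes "can_capture G C v"
  shows "cops_move G C (seize G C v)" and "captured (seize G C v) v"
  using someI_ex[OF assms[unfolded can_capture_iff]] by (simp_all add: seize_def)

text \<open>A strategy sees only the history, so the first opportunity is recomputed from it each
  time; \<open>take i h\<close> is the history before the robber reached \<open>h ! i\<close>. The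
  answer depends on the first such \<open>i\<close> alone, hence stays constant from then
  on.\<close>

definition eager :: "'a pair_pre_digraph \<Rightarrow> ('a list \<Rightarrow> 'a list) \<Rightarrow> 'a list \<Rightarrow> 'a list" where
  "eager G \<sigma> h =
     (if \<exists>i < length h. can_capture G (\<sigma> (take i h)) (h ! i)
      then let i = (LEAST i. i < length h \<and> can_capture G (\<sigma> (take i h)) (h ! i))
           in seize G (\<sigma> (take i h)) (h ! i)
      else \<sigma> h)"

lemma cops_at_eager:
  "cops_at (eager G \<sigma>) r n =
     (if \<exists>i < n. can_capture G (cops_at \<sigma> r i) (r i)
      then let i = (LEAST i. can_capture G (cops_at \<sigma> r i) (r i))
           in seize G (cops_at \<sigma> r i) (r i)
      else cops_at \<sigma> r n)"
proof -
  let ?h = "map r [0..<n]"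
  let ?P = "\<lambda>i. can_capture G (cops_at \<sigma> r i) (r i)"
  have h: "\<sigma> (take i ?h) = cops_at \<sigma> r i" "?h ! i = r i" if "i < n" for i
    using that by (simp_all add: cops_at_def take_map)
  have P: "(i < length ?h \<and> can_capture G (\<sigma> (take i ?h)) (?h ! i)) \<longleftrightarrow> i < n \<and> ?P i" for i
    using h[of i] by auto
  show ?thesis
  proof (cases "\<exists>i < n. ?P i")
    case True
    have less: "(LEAST i. ?P i) < n"
      using True Least_le[of ?P] le_less_trans by blast
    moreover have "(LEAST i. i < n \<and> ?P i) = (LEAST i. ?P i)"
    proof (rule Least_equality)
      show "(LEAST i. ?P i) < n \<and> ?P (LEAST i. ?P i)"
        using less True LeastI[of ?P] by blast
    qed (simp add: Least_le)
    ultimately show ?thesis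
      using True h by (simp add: cops_at_def[of "eager G \<sigma>"] eager_def P Let_def del: length_map)
  next
    case False
    then have "\<not> (\<exists>i < length ?h. can_capture G (\<sigma> (take i ?h)) (?h ! i))"
      using P by blast
    then have "eager G \<sigma> ?h = \<sigma> ?h"
      unfolding eager_def by (rule if_not_P)
    then show ?thesis
      unfolding if_not_P[OF False] by (simp add: cops_at_def)
  qed
qed

lemma cops_strategy_eager:
  assumes "cops_strategy G k \<sigma>"
  shows "cops_strategy G k (eager G \<sigma>)"
proof -
  have "cops_move G (cops_at (eager G \<sigma>) r n) (cops_at (eager G \<sigma>) r (Suc n))"
    if r: "robber_play G r" for r n
  proof -
    let ?P = "\<lambda>i. can_capture G (cops_at \<sigma> r i) (r i)"
    \<comment> \<open>The cops are already frozen, seize now, or still follow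
      \<open>\<sigma>\<close>. Position \<open>n\<close> looks only at indices below
      \<open>n\<close>, so seizing starts from the position that \<open>\<sigma>\<close>
      prescribes.\<close>
    consider "\<exists>i < n. ?P i" | "\<not> (\<exists>i < n. ?P i)" "?P n" | "\<not> (\<exists>i < Suc n. ?P i)"
      using less_Suc_eq by auto
    then show ?thesis
    proof cases
      case 1
      moreover from this have "\<exists>i < Suc n. ?P i" using less_SucI by blast
      ultimately show ?thesis by (simp add: cops_at_eager cops_stay)
    next
      case 2
      then have "(LEAST i. ?P i) = n"
        by (intro Least_equality) (auto simp: not_less[symmetric])
      moreover have "\<exists>i < Suc n. ?P i" using 2 by blast
      ultimately show ?thesis
        using 2(2) unfolding cops_at_eager if_not_P[OF 2(1)] by (simp add: seize(1))
    next
      case 3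
      moreover from this have "\<not> (\<exists>i < n. ?P i)" using less_SucI by blast
      ultimately show ?thesis
        using assms r by (simp only: cops_at_eager if_False cops_strategy_def)
    qed
  qed
  then show ?thesis
    using assms by (simp add: cops_strategy_def eager_def)
qed

section \<open>Lifting a strategy along a false twin\<close>

text \<open>False twins are nonadjacent, so the map contracts no edge: every neighbour to which the
  robber could flee projects to a proper neighbour of her image.\<close>

lemma confining_number_false_twin:
  assumes G': "pair_graph G'" and f: "retraction (\<lambda>v. if v = z then x else v) G' G"
    and twin: "nbhd G' z = nbhd G' x"
    and k: "confining_number G k"
  shows "confining_number G' k"
proof -
  define \<pi> where "\<pi> = (\<lambda>v. if v = z then x else v)"
  have \<pi>: "retraction \<pi> G' G" using f by (simp add: \<pi>_def)
  obtain \<sigma> where k1: "k \<ge> 1" and \<sigma>: "cops_strategy G k \<sigma>" "forces_confinement G \<sigma>"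
    using k unfolding confining_number_def by blast
  define \<tau> where "\<tau> = eager G \<sigma> \<circ> map \<pi>"
  have at: "cops_at \<tau> r n = cops_at (eager G \<sigma>) (\<pi> \<circ> r) n" for r n
    by (simp add: \<tau>_def cops_at_def)
  have play: "robber_play G (\<pi> \<circ> r)" if "robber_play G' r" for r
    using that \<pi> unfolding robber_play_def retraction_def by auto
  have closed_nbhd_mono: "closed_nbhd G v \<subseteq> closed_nbhd G' v" for v
    using \<pi> unfolding retraction_def closed_nbhd_def by blast
  then have move: "cops_move G' C C'" if "cops_move G C C'" for C C'
    using that unfolding cops_move_def by (auto elim!: list_all2_mono)
  have guard: "can_capture G' C v" if "can_capture G C v" for C v
    using that closed_nbhd_mono unfolding can_capture_def by blast
  have z_not_x: "z \<notin> nbhd G' x"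
    using nbhd_irrefl[OF G'] twin by auto
  have capt: "captured C v \<or> confined G' C v" if "captured C (\<pi> v)" for C v
    using that twin
    by (cases "v = z")
       (auto simp: \<pi>_def captured_def confined_iff can_capture_def closed_nbhd_def)
  have strat: "cops_strategy G' k \<tau>"
    using cops_strategy_eager[OF \<sigma>(1)] \<pi> play move unfolding cops_strategy_def at
    by (auto simp: \<tau>_def retraction_def)
  have conf: "confined G' C v"
    if C: "confined G C (\<pi> v)" "\<not> can_capture G C (\<pi> v)" for C v
    unfolding confined_iff
  proof
    fix w assume w: "w \<in> nbhd G' v"
    have "\<pi> w \<in> closed_nbhd G (\<pi> v)"
      using w \<pi> unfolding retraction_def closed_nbhd_def by blast
    moreover have "\<pi> w \<noteq> \<pi> v"
      using w z_not_x nbhd_sym[OF G', of z x] nbhd_irrefl[OF G'] twin by (auto simp: \<pi>_def)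
    ultimately have "\<pi> w \<in> nbhd G (\<pi> v)" by (simp add: closed_nbhd_def)
    then have cap: "can_capture G C (\<pi> w)" using C(1) unfolding confined_iff by blast
    show "can_capture G' C w"
    proof (cases "w = z")
      case False
      then show ?thesis using guard cap by (simp add: \<pi>_def)
    next
      case True
      then obtain c where c: "c \<in> set C" "x \<in> closed_nbhd G c"
        using cap by (auto simp: \<pi>_def can_capture_def)
      have "v \<in> nbhd G' x" using w True twin nbhd_sym[OF G'] by blast
      then have "\<pi> v \<in> closed_nbhd G (\<pi> x)"
        using \<pi> unfolding retraction_def closed_nbhd_def by blast
      then have "\<pi> v \<in> closed_nbhd G x" by (auto simp: \<pi>_def)
      \<comment> \<open>A cop on \<open>x\<close> guards \<open>x\<close> by staying but does not
        reach \<open>z\<close>. It would also reach the image of \<open>v\<close>, which the second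
        hypothesis excludes.\<close>
      then have "c \<noteq> x" using C(2) c(1) unfolding can_capture_def by blast
      then have "x \<in> nbhd G' c"
        using c(2) closed_nbhd_mono unfolding closed_nbhd_def by blast
      then have "z \<in> nbhd G' c" using twin nbhd_sym[OF G'] by blast
      then show ?thesis using c(1) True by (auto simp: can_capture_def closed_nbhd_def)
    qed
  qed
  have "\<exists>n. captured (cops_at \<tau> r n) (r n) \<or> captured (cops_at \<tau> r (Suc n)) (r n) \<or>
            confined G' (cops_at \<tau> r (Suc n)) (r n)" if r: "robber_play G' r" for r
  proof -
    let ?r = "\<pi> \<circ> r"
    let ?P = "\<lambda>i. can_capture G (cops_at \<sigma> ?r i) (?r i)"
    show ?thesis
    proof (cases "\<exists>i. ?P i")
      case True
      define n where "n = (LEAST i. ?P i)"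
      have "?P n" unfolding n_def using True by (rule LeastI_ex)
      \<comment> \<open>The opportunity at time \<open>n\<close> is taken in the next position of
        the cops, hence \<open>Suc n\<close>. It is the image that is seized; \<open>capt\<close>
        turns this into capture or confinement of the robber herself.\<close>
      then have "captured (cops_at \<tau> r (Suc n)) (\<pi> (r n))"
        unfolding at cops_at_eager n_def[symmetric] Let_def using seize(2) by fastforce
      then show ?thesis using capt by blast
    next
      case False
      \<comment> \<open>Without any opportunity the eager cops never deviate from
        \<open>\<sigma>\<close>.\<close>
      then have at': "cops_at \<tau> r n = cops_at \<sigma> ?r n" for n
        by (simp add: at cops_at_eager)
      obtain n where "captured (cops_at \<sigma> ?r n) (?r n) \<or>
          captured (cops_at \<sigma> ?r (Suc n)) (?r n) \<or> confined G (cops_at \<sigma> ?r (Suc n)) (?r n)"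
        using \<sigma>(2) play[OF r] unfolding forces_confinement_def by blast
      then consider "captured (cops_at \<sigma> ?r (Suc n)) (?r n)"
        | "confined G (cops_at \<sigma> ?r (Suc n)) (?r n)"
        using False captured_imp_can_capture[of "cops_at \<sigma> ?r n" "?r n" G] by metis
      then show ?thesis
      proof cases
        case 1
        then show ?thesis using capt unfolding at' by auto
      next
        case 2
        have "?r (Suc n) \<in> closed_nbhd G (?r n)"
          using play[OF r] unfolding robber_play_def by blast
        \<comment> \<open>Moving the image to a neighbour would give the cops an opportunity at time
          \<open>Suc n\<close>. So the image stays, and the absence of an opportunity at that time
          yields the second hypothesis of \<open>conf\<close>.\<close>
        then have "?r (Suc n) = ?r n"
          using 2 False unfolding confined_iff closed_nbhd_def by blast
        then have "\<not> can_capture G (cops_at \<sigma> ?r (Suc n)) (?r n)"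
          using False by metis
        then show ?thesis using 2 conf unfolding at' by auto
      qed
    qed
  qed
  then have "forces_confinement G' \<tau>" unfolding forces_confinement_def by blast
  then show ?thesis using strat k1 unfolding confining_number_def by blast
qed

section \<open>Twins give retractions\<close>

lemma adds_vertex_nbhd:
  assumes "adds_vertex G y G'"
  shows "nbhd G v = (if v \<in> pverts G then nbhd G' v \<inter> pverts G else {})"
proof -
  have "parcs G = {e \<in> parcs G'. fst e \<in> pverts G \<and> snd e \<in> pverts G}"
    using assms by (auto simp: adds_vertex_def induced_subgraph_def)
  then show ?thesis by (auto simp: nbhd_iff)
qed

text \<open>The hypothesis on neighbourhoods is common to true and false twins, so both parts of the
  theorem use the same map.\<close>

lemma twin_retraction:
  assumes x: "x \<in> pverts G" and y: "adds_vertex G y G'"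
    and twin: "nbhd G' y - {x} = nbhd G' x - {y}"
  shows "retraction (\<lambda>v. if v = y then x else v) G' G"
proof -
  let ?f = "\<lambda>v. if v = y then x else v"
  have G': "pair_graph G'" and verts: "y \<notin> pverts G" "pverts G' = insert y (pverts G)"
    using y by (auto simp: adds_vertex_def)
  note N = adds_vertex_nbhd[OF y]
  have "?f w \<in> closed_nbhd G (?f v)" if vw: "w \<in> nbhd G' v" for v w
  proof -
    have wv: "v \<in> nbhd G' w" using nbhd_sym[OF G'] vw by blast
    have mem: "v \<in> insert y (pverts G)" "w \<in> insert y (pverts G)" and "v \<noteq> w"
      using vw wv nbhd_subset_pverts[OF G'] nbhd_irrefl[OF G'] verts(2) by blast+
    \<comment> \<open>The edge between the twins collapses to \<open>x\<close>, any other edge at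
      \<open>y\<close> is carried to one at \<open>x\<close>, and the remaining edges are
      fixed.\<close>
    consider "v = y" "w = x" | "v = x" "w = y" | "v = y" "w \<noteq> x" "w \<noteq> y"
      | "w = y" "v \<noteq> x" "v \<noteq> y" | "v \<noteq> y" "w \<noteq> y"
      using \<open>v \<noteq> w\<close> by blast
    then show ?thesis
    proof cases
      case 3
      then have "w \<in> nbhd G' x" using twin vw by blast
      then show ?thesis using 3 x mem N[of x] by (simp add: closed_nbhd_def)
    next
      case 4
      then have "v \<in> nbhd G' x" using twin wv by blast
      then have "x \<in> nbhd G' v" using nbhd_sym[OF G'] by blast
      then show ?thesis using 4 x mem N[of v] by (simp add: closed_nbhd_def)
    next
      case 5
      then show ?thesis using vw mem N[of v] by (simp add: closed_nbhd_def)
    qed (simp_all add: closed_nbhd_def)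
  qed
  moreover have "?f v \<in> closed_nbhd G (?f v)" for v
    by (simp add: closed_nbhd_def)
  ultimately have "\<forall>v. \<forall>w \<in> closed_nbhd G' v. ?f w \<in> closed_nbhd G (?f v)"
    unfolding closed_nbhd_def[of G'] by blast
  moreover have "nbhd G v \<subseteq> nbhd G' v" for v
    by (simp add: N)
  ultimately show ?thesis
    using x verts unfolding retraction_def by auto
qed

theorem theorem3p3:
  fixes G1 G2 G3 :: "'a pair_pre_digraph" and x y z :: 'a
  assumes "cograph G1" and "x \<in> pverts G1"
  shows "(adds_true_twin G1 x y G2 \<longrightarrow> ccn G1 \<le> ccn G2) \<and>
         (adds_false_twin G1 x z G3 \<longrightarrow> ccn G1 = ccn G3)"
proof (intro conjI impI)
  have G1: "pair_graph G1" using assms(1) by (simp add: cograph_def)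
  {
    assume "adds_true_twin G1 x y G2"
    then have y: "adds_vertex G1 y G2" and twin: "closed_nbhd G2 y = closed_nbhd G2 x"
      by (simp_all add: adds_true_twin_def)
    then have G2: "pair_graph G2" "pverts G2 \<noteq> {}" by (simp_all add: adds_vertex_def)
    have "nbhd G2 y - {x} = nbhd G2 x - {y}"
      using twin nbhd_irrefl[OF G2(1)] unfolding closed_nbhd_def by blast
    from twin_retraction[OF assms(2) y this] show "ccn G1 \<le> ccn G2"
      using ccn_mono[OF G2] confining_number_retract[OF G1] by blast
  next
    assume "adds_false_twin G1 x z G3"
    then have z: "adds_vertex G1 z G3" and twin: "nbhd G3 z = nbhd G3 x"
      by (simp_all add: adds_false_twin_def)
    then have G3: "pair_graph G3" "pverts G3 \<noteq> {}"
      by (simp_all add: adds_vertex_def)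
    \<comment> \<open>By irreflexivity the common neighbourhood contains neither \<open>x\<close>
      nor \<open>z\<close>, so the removals change nothing.\<close>
    have "nbhd G3 z - {x} = nbhd G3 x - {z}"
      using twin nbhd_irrefl[OF G3(1)] by blast
    note f = twin_retraction[OF assms(2) z this]
    have "ccn G1 \<le> ccn G3"
      using ccn_mono[OF G3] confining_number_retract[OF G1 f] by blast
    moreover have "ccn G3 \<le> ccn G1"
      using ccn_mono[OF G1] assms(2) confining_number_false_twin[OF G3(1) f twin] by blast
    ultimately show "ccn G1 = ccn G3" by simp
  }
qed

end
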